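(* Let $(E,\tau)$ be a locally convex space with a fundamental sequence $(B_n)_n$ of bounded sets. Then there exists a finest locally convex topology $\xi$ on $E$ having the same bounded sets as $\tau$, and $(E,\xi)$ has a $\mathfrak{G}$-base and has the strong Pytkeev property. Moreover, if $(E,\tau)$ is bornological, then $\tau=\xi$.
   Context: A fundamental sequence of bounded sets is a sequence of bounded sets such that every bounded set lies in one of them. An lcs is bornological if every absolutely convex bornivorous set is a neighborhood of zero. A $\mathfrak{G}$-base is a base $\{U_\alpha:\alpha\in\mathbb{N}^\mathbb{N}\}$ of neighborhoods of zero with $U_\beta\subseteq U_\alpha$ whenever $\alpha\le\beta$ coordinatewise. A space has the strong Pytkeev property if for each point $x$ there is a countable family $\mathcal{D}$ of subsets such that for each neighborhood $U$ of $x$ and each $A$ with $x\in\overline{A}\setminus A$ there is $D\in\mathcal{D}$ with $D\subseteq U$ and $D\cap A$ infinite. *)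

theory Defs
  imports "HOL-Analysis.Analysis"
begin

text \<open>Topological vector space structure on a real vector space (topology on the whole type).\<close>
definition tvs_topology :: "'a::real_vector topology \<Rightarrow> bool" where
  "tvs_topology T \<longleftrightarrow>
     topspace T = UNIV \<and>
     continuous_map (prod_topology T T) T (\<lambda>(x, y). x + y) \<and>
     continuous_map (prod_topology euclideanreal T) T (\<lambda>(c, x). c *\<^sub>R x)"

text \<open>Hausdorff locally convex topology: a tvs topology in which every neighbourhood
  of zero contains a convex open neighbourhood of zero.\<close>
definition lcs_topology :: "'a::real_vector topology \<Rightarrow> bool" where
  "lcs_topology T \<longleftrightarrow> tvs_topology T \<and> Hausdorff_space T \<and>
     (\<forall>U. openin T U \<and> 0 \<in> U \<longrightarrow> (\<exists>V. openin T V \<and> 0 \<in> V \<and> convex V \<and> V \<subseteq> U))"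

definition nhd0 :: "'a::real_vector topology \<Rightarrow> 'a set \<Rightarrow> bool" where
  "nhd0 T U \<longleftrightarrow> (\<exists>V. openin T V \<and> 0 \<in> V \<and> V \<subseteq> U)"

text \<open>A set absorbs another: some positive multiple of it covers the other.\<close>
definition absorbs :: "'a::real_vector set \<Rightarrow> 'a set \<Rightarrow> bool" where
  "absorbs U B \<longleftrightarrow> (\<exists>c>0. B \<subseteq> (\<lambda>x. c *\<^sub>R x) ` U)"

definition tvs_bounded :: "'a::real_vector topology \<Rightarrow> 'a set \<Rightarrow> bool" where
  "tvs_bounded T B \<longleftrightarrow> (\<forall>U. nhd0 T U \<longrightarrow> absorbs U B)"

definition fundamental_sequence_bounded :: "'a::real_vector topology \<Rightarrow> (nat \<Rightarrow> 'a set) \<Rightarrow> bool" where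
  "fundamental_sequence_bounded T Bs \<longleftrightarrow>
     (\<forall>n. tvs_bounded T (Bs n)) \<and> (\<forall>B. tvs_bounded T B \<longrightarrow> (\<exists>n. B \<subseteq> Bs n))"

definition balanced_set :: "'a::real_vector set \<Rightarrow> bool" where
  "balanced_set S \<longleftrightarrow> (\<forall>x\<in>S. \<forall>c::real. \<bar>c\<bar> \<le> 1 \<longrightarrow> c *\<^sub>R x \<in> S)"

definition absolutely_convex :: "'a::real_vector set \<Rightarrow> bool" where
  "absolutely_convex S \<longleftrightarrow> convex S \<and> balanced_set S"

definition bornivorous :: "'a::real_vector topology \<Rightarrow> 'a set \<Rightarrow> bool" where
  "bornivorous T S \<longleftrightarrow> (\<forall>B. tvs_bounded T B \<longrightarrow> absorbs S B)"

definition bornological :: "'a::real_vector topology \<Rightarrow> bool" where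
  "bornological T \<longleftrightarrow> (\<forall>S. absolutely_convex S \<and> bornivorous T S \<longrightarrow> nhd0 T S)"

text \<open>A \<open>\<GG>\<close>-base: a base of neighbourhoods of zero indexed by \<open>\<nat>\<^sup>\<nat>\<close>, decreasing
  with respect to the coordinatewise order.\<close>
definition has_G_base :: "'a::real_vector topology \<Rightarrow> bool" where
  "has_G_base T \<longleftrightarrow> (\<exists>U :: (nat \<Rightarrow> nat) \<Rightarrow> 'a set.
     (\<forall>\<alpha>. nhd0 T (U \<alpha>)) \<and>
     (\<forall>W. nhd0 T W \<longrightarrow> (\<exists>\<alpha>. U \<alpha> \<subseteq> W)) \<and>
     (\<forall>\<alpha> \<beta>. (\<forall>i. \<alpha> i \<le> \<beta> i) \<longrightarrow> U \<beta> \<subseteq> U \<alpha>))"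

definition strong_Pytkeev :: "'b topology \<Rightarrow> bool" where
  "strong_Pytkeev T \<longleftrightarrow> (\<forall>x\<in>topspace T. \<exists>\<D>. countable \<D> \<and> (\<forall>D\<in>\<D>. D \<subseteq> topspace T) \<and>
     (\<forall>U A. openin T U \<and> x \<in> U \<and> A \<subseteq> topspace T \<and> x \<in> (T closure_of A) - A \<longrightarrow>
        (\<exists>D\<in>\<D>. D \<subseteq> U \<and> infinite (D \<inter> A))))"

end

theory Submission
  imports Defs
begin

text \<open>The finest locally convex topology \<open>\<xi>\<close> with the bounded sets of \<open>\<tau>\<close> is the one whose
  neighbourhoods of zero are the absolutely convex bornivorous sets: in any locally convex
  topology with the same bounded sets every absolutely convex neighbourhood of zero is
  bornivorous, and if \<open>\<tau>\<close> is bornological the bornivorous discs are already \<open>\<tau>\<close>-neighbourhoods.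

  Since every bornivorous disc absorbs each \<open>B\<^sub>n\<close>, the convex hulls
  \<open>U\<^sub>\<alpha> = conv (\<Union>n. bal B\<^sub>n / (\<alpha> n + 1))\<close> form a \<open>\<GG>\<close>-base of \<open>\<xi>\<close>. A point of a
  convex hull is a combination of finitely many points, so membership in \<open>U\<^sub>\<alpha>\<close> is decided by
  a finite prefix of \<open>\<alpha>\<close>. Hence the countably many sets \<open>D\<^sub>s = \<Inter>{U\<^sub>\<beta> | \<beta> extends s}\<close>
  witness the strong Pytkeev property at \<open>x\<close>: if every \<open>x + D\<^sub>s\<close> inside a neighbourhood met
  \<open>A\<close> only finitely often, one could choose \<open>\<alpha>\<close> coordinate by coordinate so that all
  \<open>x + D\<^bsub>\<alpha>|n\<^esub>\<close> miss \<open>A\<close>, although the neighbourhood \<open>x + U\<^sub>\<alpha>\<close> of \<open>x \<in> closure A\<close> meets \<open>A\<close>.\<close>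

section \<open>Balanced sets and topological vector spaces\<close>

lemma translation_image_iff:
  fixes x :: "'a::ab_group_add"
  shows "z \<in> (+) x ` S \<longleftrightarrow> z - x \<in> S"
  by (force simp: image_iff algebra_simps)

lemma scaleR_image_iff:
  fixes z :: "'a::real_vector"
  assumes "c \<noteq> 0"
  shows "z \<in> (*\<^sub>R) c ` S \<longleftrightarrow> z /\<^sub>R c \<in> S"
  using assms by (force simp: image_iff)

lemma balanced_setD: "balanced_set S \<Longrightarrow> x \<in> S \<Longrightarrow> \<bar>c\<bar> \<le> 1 \<Longrightarrow> c *\<^sub>R x \<in> S"
  unfolding balanced_set_def by blast

lemma balanced_set_scaleR_image:
  assumes "balanced_set S"
  shows "balanced_set ((*\<^sub>R) c ` S)"
  unfolding balanced_set_def
proof (intro ballI allI impI)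
  fix y and t :: real
  assume "y \<in> (*\<^sub>R) c ` S" "\<bar>t\<bar> \<le> 1"
  then obtain x where "x \<in> S" "y = c *\<^sub>R x" "\<bar>t\<bar> \<le> 1" by blast
  then show "t *\<^sub>R y \<in> (*\<^sub>R) c ` S"
    using balanced_setD[OF assms] by (auto simp: image_iff intro!: bexI[of _ "t *\<^sub>R x"])
qed

lemma balanced_set_scaleR_image_mono:
  assumes "balanced_set S" "0 < c" "c \<le> d"
  shows "(*\<^sub>R) c ` S \<subseteq> (*\<^sub>R) d ` S"
proof
  fix z assume "z \<in> (*\<^sub>R) c ` S"
  then obtain s where s: "s \<in> S" "z = c *\<^sub>R s" by blast
  have "(c/d) *\<^sub>R s \<in> S" using assms s by (intro balanced_setD) auto
  moreover have "z = d *\<^sub>R ((c/d) *\<^sub>R s)" using assms s by simp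
  ultimately show "z \<in> (*\<^sub>R) d ` S" by blast
qed

lemma balanced_set_convex_hull:
  assumes "balanced_set S"
  shows "balanced_set (convex hull S)"
  unfolding balanced_set_def
proof (intro ballI allI impI)
  fix x and c :: real
  assume "x \<in> convex hull S" "\<bar>c\<bar> \<le> 1"
  then have "c *\<^sub>R x \<in> (*\<^sub>R) c ` (convex hull S)" by blast
  also have "\<dots> = convex hull ((*\<^sub>R) c ` S)" by (simp add: convex_hull_scaling)
  also have "\<dots> \<subseteq> convex hull S"
    using balanced_setD[OF assms] \<open>\<bar>c\<bar> \<le> 1\<close> by (intro hull_mono) blast
  finally show "c *\<^sub>R x \<in> convex hull S" .
qed

lemma balanced_set_UN: "(\<And>n. balanced_set (S n)) \<Longrightarrow> balanced_set (\<Union>n. S n)"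
  unfolding balanced_set_def by blast

lemma convex_balanced_half_sum:
  fixes a b :: "'a::real_vector"
  assumes "convex S" "a \<in> (*\<^sub>R) (1/2) ` S" "b \<in> (*\<^sub>R) (1/2) ` S"
  shows "a + b \<in> S"
proof -
  have "(1/2) *\<^sub>R (2 *\<^sub>R a) + (1/2) *\<^sub>R (2 *\<^sub>R b) \<in> S"
    using assms by (intro convexD) (auto simp: scaleR_image_iff)
  then show ?thesis by (simp add: scaleR_add_right[symmetric])
qed

lemma absorbs_mono: "absorbs S B \<Longrightarrow> S \<subseteq> U \<Longrightarrow> absorbs U B"
  unfolding absorbs_def by blast

lemma nhd0_openI: "openin T V \<Longrightarrow> 0 \<in> V \<Longrightarrow> V \<subseteq> U \<Longrightarrow> nhd0 T U"
  unfolding nhd0_def by blast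

lemma tvs_bounded_zero: "tvs_bounded T {0}"
  unfolding tvs_bounded_def absorbs_def nhd0_def
  by (auto intro!: exI[of _ 1])

lemma tvs_topspace: "tvs_topology T \<Longrightarrow> topspace T = UNIV"
  by (simp add: tvs_topology_def)

lemma lcs_tvs: "lcs_topology T \<Longrightarrow> tvs_topology T"
  by (simp add: lcs_topology_def)

lemma continuous_map_tvs_add_left:
  assumes "tvs_topology T"
  shows "continuous_map T T ((+) x)"
proof -
  have "continuous_map T (prod_topology T T) (\<lambda>y. (x, y))"
    using assms by (simp add: continuous_map_paired tvs_topology_def)
  then show ?thesis
    using assms continuous_map_compose unfolding tvs_topology_def o_def by fastforce
qed

lemma continuous_map_tvs_scaleR:
  assumes "tvs_topology T"
  shows "continuous_map T T ((*\<^sub>R) c)"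
proof -
  have "continuous_map T (prod_topology euclideanreal T) (\<lambda>y. (c, y))"
    using assms by (simp add: continuous_map_paired tvs_topology_def)
  then show ?thesis
    using assms continuous_map_compose unfolding tvs_topology_def o_def by fastforce
qed

lemma continuous_map_tvs_scaleR_point:
  assumes "tvs_topology T"
  shows "continuous_map euclideanreal T (\<lambda>c. c *\<^sub>R x)"
proof -
  have "continuous_map euclideanreal (prod_topology euclideanreal T) (\<lambda>c. (c, x))"
    using assms by (simp add: continuous_map_paired tvs_topology_def)
  then show ?thesis
    using assms continuous_map_compose unfolding tvs_topology_def o_def by fastforce
qed

lemma openin_tvs_translation:
  assumes "tvs_topology T" "openin T V"
  shows "openin T ((+) x ` V)"
proof -
  have "openin T {y \<in> topspace T. - x + y \<in> V}"
    by (rule openin_continuous_map_preimage[OF continuous_map_tvs_add_left[OF assms(1)] assms(2)])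
  also have "{y \<in> topspace T. - x + y \<in> V} = (+) x ` V"
    using assms(1) by (auto simp: translation_image_iff tvs_topspace)
  finally show ?thesis .
qed

lemma openin_tvs_scaleR:
  assumes "tvs_topology T" "openin T V" "c \<noteq> 0"
  shows "openin T ((*\<^sub>R) c ` V)"
proof -
  have "(*\<^sub>R) c ` V = {y \<in> topspace T. inverse c *\<^sub>R y \<in> V}"
    using assms by (auto simp: scaleR_image_iff tvs_topspace)
  then show ?thesis
    using openin_continuous_map_preimage[OF continuous_map_tvs_scaleR[OF assms(1)] assms(2)]
    by simp
qed

lemma tvs_bounded_singleton:
  assumes "tvs_topology T"
  shows "tvs_bounded T {x}"
  unfolding tvs_bounded_def
proof (intro allI impI)
  fix U assume "nhd0 T U"
  then obtain V where V: "openin T V" "0 \<in> V" "V \<subseteq> U" using nhd0_def by blast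
  have "open {c. c *\<^sub>R x \<in> V}"
    using openin_continuous_map_preimage[OF continuous_map_tvs_scaleR_point[OF assms] V(1)]
    by simp
  moreover have "0 \<in> {c. c *\<^sub>R x \<in> V}" using V by simp
  ultimately obtain e where e: "e > 0" "\<And>y. dist y 0 < e \<Longrightarrow> y *\<^sub>R x \<in> V"
    unfolding open_dist by blast
  have "(e/2) *\<^sub>R x \<in> U" using e V by auto
  then have "x \<in> (*\<^sub>R) (2/e) ` U" using e by (intro image_eqI[of _ _ "(e/2) *\<^sub>R x"]) auto
  then show "absorbs U {x}"
    using e unfolding absorbs_def by (intro exI[of _ "2/e"]) auto
qed

lemma lcs_absolutely_convex_nhd:
  assumes "lcs_topology T" "openin T U" "0 \<in> U"
  obtains W where "openin T W" "0 \<in> W" "absolutely_convex W" "W \<subseteq> U"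
proof -
  obtain V where V: "openin T V" "0 \<in> V" "convex V" "V \<subseteq> U"
    using assms unfolding lcs_topology_def by blast
  define W where "W = V \<inter> (*\<^sub>R) (-1) ` V"
  have W_iff: "x \<in> W \<longleftrightarrow> x \<in> V \<and> -x \<in> V" for x by (force simp: W_def image_iff)
  have "openin T W"
    unfolding W_def by (intro openin_Int V(1) openin_tvs_scaleR[OF lcs_tvs[OF assms(1)]]) simp
  moreover have "0 \<in> W" using V by (simp add: W_iff)
  moreover have "convex W" unfolding W_def using V(3) by (intro convex_Int convex_scaling)
  moreover have "balanced_set W" unfolding balanced_set_def
  proof (intro ballI allI impI)
    fix x and c :: real assume "x \<in> W" "\<bar>c\<bar> \<le> 1"
    then have x: "x \<in> V" "-x \<in> V" and c: "0 \<le> (1+c)/2" "0 \<le> (1-c)/2" by (auto simp: W_iff)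
    \<comment> \<open>\<open>c x\<close> and \<open>- c x\<close> are convex combinations of \<open>x\<close> and \<open>-x\<close>\<close>
    have "((1+c)/2) *\<^sub>R x + ((1-c)/2) *\<^sub>R (-x) \<in> V" "((1-c)/2) *\<^sub>R x + ((1+c)/2) *\<^sub>R (-x) \<in> V"
      using convexD[OF V(3) x] c by (auto simp: field_simps)
    moreover have "((1+c)/2) *\<^sub>R x + ((1-c)/2) *\<^sub>R (-x) = c *\<^sub>R x"
      "((1-c)/2) *\<^sub>R x + ((1+c)/2) *\<^sub>R (-x) = - (c *\<^sub>R x)"
      by (simp_all add: algebra_simps flip: scaleR_diff_left add_divide_distrib diff_divide_distrib)
    ultimately show "c *\<^sub>R x \<in> W" by (simp add: W_iff)
  qed
  ultimately show ?thesis using that V(4) unfolding absolutely_convex_def W_def by blast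
qed

section \<open>The bornological topology\<close>

definition bornivorous_discs :: "'a::real_vector topology \<Rightarrow> 'a set set" where
  "bornivorous_discs T = {S. absolutely_convex S \<and> bornivorous T S}"

lemma bornivorous_discsD:
  assumes "S \<in> bornivorous_discs T"
  shows bornivorous_disc_convex: "convex S"
    and bornivorous_disc_balanced: "balanced_set S"
    and bornivorous_disc_absorbs: "tvs_bounded T B \<Longrightarrow> absorbs S B"
  using assms by (auto simp: bornivorous_discs_def absolutely_convex_def bornivorous_def)

lemma bornivorous_discsI:
  "convex S \<Longrightarrow> balanced_set S \<Longrightarrow> (\<And>B. tvs_bounded T B \<Longrightarrow> absorbs S B)
    \<Longrightarrow> S \<in> bornivorous_discs T"
  by (auto simp: bornivorous_discs_def absolutely_convex_def bornivorous_def)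

lemma zero_mem_bornivorous_disc:
  assumes "S \<in> bornivorous_discs T"
  shows "0 \<in> S"
proof -
  obtain c s where "s \<in> S" "0 = c *\<^sub>R s"
    using bornivorous_disc_absorbs[OF assms tvs_bounded_zero] by (auto simp: absorbs_def)
  then show ?thesis using balanced_setD[OF bornivorous_disc_balanced[OF assms], of s 0] by simp
qed

lemma UNIV_bornivorous_disc: "UNIV \<in> bornivorous_discs T"
  by (intro bornivorous_discsI) (auto simp: balanced_set_def absorbs_def intro!: exI[of _ 1])

lemma bornivorous_discs_Int:
  assumes S: "S \<in> bornivorous_discs T" and S': "S' \<in> bornivorous_discs T"
  shows "S \<inter> S' \<in> bornivorous_discs T"
proof (rule bornivorous_discsI)
  fix B assume "tvs_bounded T B"
  then obtain c c' where "c > 0" "B \<subseteq> (*\<^sub>R) c ` S" "c' > 0" "B \<subseteq> (*\<^sub>R) c' ` S'"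
    using bornivorous_disc_absorbs[OF S] bornivorous_disc_absorbs[OF S'] unfolding absorbs_def
    by blast
  then have "B \<subseteq> (*\<^sub>R) (max c c') ` S" "B \<subseteq> (*\<^sub>R) (max c c') ` S'"
    using balanced_set_scaleR_image_mono[OF bornivorous_disc_balanced[OF S], of c "max c c'"]
      balanced_set_scaleR_image_mono[OF bornivorous_disc_balanced[OF S'], of c' "max c c'"]
    by auto
  moreover have "max c c' \<noteq> 0" using \<open>c > 0\<close> by linarith
  ultimately have "B \<subseteq> (*\<^sub>R) (max c c') ` (S \<inter> S')"
    by (auto simp: subset_iff scaleR_image_iff)
  then show "absorbs (S \<inter> S') B"
    using \<open>c > 0\<close> unfolding absorbs_def by (intro exI[of _ "max c c'"]) auto
next
  show "convex (S \<inter> S')" using S S' by (intro convex_Int bornivorous_disc_convex)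
  show "balanced_set (S \<inter> S')"
    using bornivorous_disc_balanced[OF S] bornivorous_disc_balanced[OF S']
    unfolding balanced_set_def by blast
qed

lemma bornivorous_discs_scaleR:
  assumes S: "S \<in> bornivorous_discs T" and "c > 0"
  shows "(*\<^sub>R) c ` S \<in> bornivorous_discs T"
proof (rule bornivorous_discsI)
  show "convex ((*\<^sub>R) c ` S)" using bornivorous_disc_convex[OF S] by (rule convex_scaling)
  show "balanced_set ((*\<^sub>R) c ` S)" using bornivorous_disc_balanced[OF S]
    by (rule balanced_set_scaleR_image)
  fix B assume "tvs_bounded T B"
  then obtain d where "d > 0" "B \<subseteq> (*\<^sub>R) d ` S"
    using bornivorous_disc_absorbs[OF S] unfolding absorbs_def by blast
  moreover have "(*\<^sub>R) (d/c) ` ((*\<^sub>R) c ` S) = (*\<^sub>R) d ` S"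
    using \<open>c > 0\<close> by (simp add: image_image)
  moreover have "d/c > 0" using \<open>d > 0\<close> \<open>c > 0\<close> by simp
  ultimately show "absorbs ((*\<^sub>R) c ` S) B"
    unfolding absorbs_def by (intro exI[of _ "d/c"]) simp
qed

lemma bornivorous_disc_radial:
  assumes "tvs_topology T" "S \<in> bornivorous_discs T"
  obtains d where "d > 0" "\<And>t. \<bar>t\<bar> \<le> d \<Longrightarrow> t *\<^sub>R x \<in> S"
proof -
  obtain k s where k: "k > 0" "s \<in> S" "x = k *\<^sub>R s"
    using bornivorous_disc_absorbs[OF assms(2) tvs_bounded_singleton[OF assms(1)]]
    unfolding absorbs_def by blast
  have "t *\<^sub>R x \<in> S" if "\<bar>t\<bar> \<le> 1/k" for t
    using balanced_setD[OF bornivorous_disc_balanced[OF assms(2)] k(2), of "t * k"] that k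
    by (simp add: abs_mult field_simps)
  moreover have "1/k > 0" using k by simp
  ultimately show ?thesis using that by blast
qed

lemma bornivorous_disc_of_nhd0:
  assumes "nhd0 \<sigma> W" "absolutely_convex W" "\<And>B. tvs_bounded T B \<Longrightarrow> tvs_bounded \<sigma> B"
  shows "W \<in> bornivorous_discs T"
  using assms by (auto simp: bornivorous_discs_def bornivorous_def tvs_bounded_def)

definition bornological_topology :: "'a::real_vector topology \<Rightarrow> 'a topology" where
  "bornological_topology T =
     topology (\<lambda>U. \<forall>x\<in>U. \<exists>S\<in>bornivorous_discs T. (+) x ` S \<subseteq> U)"

lemma openin_bornological_topology:
  "openin (bornological_topology T) U \<longleftrightarrow> (\<forall>x\<in>U. \<exists>S\<in>bornivorous_discs T. (+) x ` S \<subseteq> U)"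
proof -
  have "istopology (\<lambda>U. \<forall>x\<in>U. \<exists>S\<in>bornivorous_discs T. (+) x ` S \<subseteq> U)"
    unfolding istopology_def
  proof (intro conjI allI impI)
    fix U V
    assume U: "\<forall>x\<in>U. \<exists>S\<in>bornivorous_discs T. (+) x ` S \<subseteq> U"
      and V: "\<forall>x\<in>V. \<exists>S\<in>bornivorous_discs T. (+) x ` S \<subseteq> V"
    show "\<forall>x\<in>U \<inter> V. \<exists>S\<in>bornivorous_discs T. (+) x ` S \<subseteq> U \<inter> V"
    proof
      fix x assume x: "x \<in> U \<inter> V"
      obtain S where S: "S \<in> bornivorous_discs T" "(+) x ` S \<subseteq> U"
        using bspec[OF U IntD1[OF x]] ..
      obtain S' where S': "S' \<in> bornivorous_discs T" "(+) x ` S' \<subseteq> V"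
        using bspec[OF V IntD2[OF x]] ..
      have "(+) x ` (S \<inter> S') \<subseteq> U \<inter> V" using S(2) S'(2) by auto
      moreover have "S \<inter> S' \<in> bornivorous_discs T" using S(1) S'(1) by (rule bornivorous_discs_Int)
      ultimately show "\<exists>S\<in>bornivorous_discs T. (+) x ` S \<subseteq> U \<inter> V" ..
    qed
  next
    fix \<U>
    assume H: "\<forall>U\<in>\<U>. \<forall>x\<in>U. \<exists>S\<in>bornivorous_discs T. (+) x ` S \<subseteq> U"
    show "\<forall>x\<in>\<Union>\<U>. \<exists>S\<in>bornivorous_discs T. (+) x ` S \<subseteq> \<Union>\<U>"
    proof
      fix x assume "x \<in> \<Union>\<U>"
      then obtain U where U: "U \<in> \<U>" "x \<in> U" ..
      obtain S where "S \<in> bornivorous_discs T" "(+) x ` S \<subseteq> U"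
        using bspec[OF bspec[OF H U(1)] U(2)] ..
      then show "\<exists>S\<in>bornivorous_discs T. (+) x ` S \<subseteq> \<Union>\<U>" using U(1) by auto
    qed
  qed
  then show ?thesis unfolding bornological_topology_def by (simp only: topology_inverse')
qed

lemma topspace_bornological_topology: "topspace (bornological_topology T) = UNIV"
proof -
  have "openin (bornological_topology T) UNIV"
    using UNIV_bornivorous_disc by (auto simp: openin_bornological_topology)
  then show ?thesis using openin_subset by blast
qed

lemma openin_bornological_topology_translation:
  assumes "openin (bornological_topology T) U"
  shows "openin (bornological_topology T) ((+) x ` U)"
  unfolding openin_bornological_topology
proof
  fix z assume "z \<in> (+) x ` U"
  then have "z - x \<in> U" by (simp add: translation_image_iff)
  obtain S where S: "S \<in> bornivorous_discs T" "(+) (z - x) ` S \<subseteq> U"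
    using bspec[OF assms[unfolded openin_bornological_topology] \<open>z - x \<in> U\<close>] ..
  have "(+) z ` S = (+) x ` ((+) (z - x) ` S)" by (simp add: image_image)
  then have "(+) z ` S \<subseteq> (+) x ` U" using S(2) by (metis image_mono)
  then show "\<exists>S\<in>bornivorous_discs T. (+) z ` S \<subseteq> (+) x ` U" using S(1) ..
qed

lemma in_interior_of_bornological_topology:
  "x \<in> bornological_topology T interior_of S \<longleftrightarrow> (\<exists>W\<in>bornivorous_discs T. (+) x ` W \<subseteq> S)"
proof
  assume "x \<in> bornological_topology T interior_of S"
  then obtain W where "W \<in> bornivorous_discs T" "(+) x ` W \<subseteq> bornological_topology T interior_of S"
    using openin_interior_of[of "bornological_topology T" S, unfolded openin_bornological_topology]
    by blast
  then show "\<exists>W\<in>bornivorous_discs T. (+) x ` W \<subseteq> S"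
    using interior_of_subset subset_trans by metis
next
  define I where "I = {y. \<exists>W\<in>bornivorous_discs T. (+) y ` W \<subseteq> S}"
  have "openin (bornological_topology T) I"
    unfolding openin_bornological_topology
  proof
    fix y assume "y \<in> I"
    then obtain W where W: "W \<in> bornivorous_discs T" "(+) y ` W \<subseteq> S" by (auto simp: I_def)
    define H where "H = (*\<^sub>R) (1/2) ` W"
    have H: "H \<in> bornivorous_discs T" unfolding H_def using W(1) by (simp add: bornivorous_discs_scaleR)
    have "(+) z ` H \<subseteq> S" if "z \<in> (+) y ` H" for z
    proof
      fix w assume "w \<in> (+) z ` H"
      then have "(w - z) + (z - y) \<in> W"
        using \<open>z \<in> (+) y ` H\<close> bornivorous_disc_convex[OF W(1)]
        by (intro convex_balanced_half_sum) (auto simp: H_def translation_image_iff)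
      then show "w \<in> S" using W(2) by (auto simp: translation_image_iff)
    qed
    then have "(+) y ` H \<subseteq> I" using H unfolding I_def by blast
    then show "\<exists>H\<in>bornivorous_discs T. (+) y ` H \<subseteq> I" using H ..
  qed
  moreover have "I \<subseteq> S"
  proof
    fix y assume "y \<in> I"
    then obtain W where "W \<in> bornivorous_discs T" "(+) y ` W \<subseteq> S" by (auto simp: I_def)
    then show "y \<in> S" using zero_mem_bornivorous_disc[of W T] by force
  qed
  ultimately have "I \<subseteq> bornological_topology T interior_of S" by (rule interior_of_maximal[rotated])
  then show "\<exists>W\<in>bornivorous_discs T. (+) x ` W \<subseteq> S \<Longrightarrow> x \<in> bornological_topology T interior_of S"
    by (auto simp: I_def)
qed

lemma zero_mem_interior_of_bornivorous_disc:
  "S \<in> bornivorous_discs T \<Longrightarrow> 0 \<in> bornological_topology T interior_of S"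
  by (auto simp: in_interior_of_bornological_topology)

lemma nhd0_bornological_topology_iff:
  "nhd0 (bornological_topology T) U \<longleftrightarrow> (\<exists>S\<in>bornivorous_discs T. S \<subseteq> U)"
proof
  assume "nhd0 (bornological_topology T) U"
  then obtain V where "openin (bornological_topology T) V" "0 \<in> V" "V \<subseteq> U"
    unfolding nhd0_def by blast
  then obtain S where "S \<in> bornivorous_discs T" "(+) 0 ` S \<subseteq> V"
    unfolding openin_bornological_topology by blast
  then show "\<exists>S\<in>bornivorous_discs T. S \<subseteq> U" using \<open>V \<subseteq> U\<close> by auto
next
  assume "\<exists>S\<in>bornivorous_discs T. S \<subseteq> U"
  then obtain S where "S \<in> bornivorous_discs T" "S \<subseteq> U" by blast
  then show "nhd0 (bornological_topology T) U"
    using interior_of_subset[of "bornological_topology T" S]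
    by (intro nhd0_openI[OF openin_interior_of zero_mem_interior_of_bornivorous_disc]) auto
qed

lemma openin_bornological_topologyI:
  assumes "lcs_topology \<sigma>" "\<And>B. tvs_bounded T B \<Longrightarrow> tvs_bounded \<sigma> B" "openin \<sigma> U"
  shows "openin (bornological_topology T) U"
  unfolding openin_bornological_topology
proof
  fix x assume "x \<in> U"
  have "openin \<sigma> ((+) (-x) ` U)" by (rule openin_tvs_translation[OF lcs_tvs[OF assms(1)] assms(3)])
  moreover have "0 \<in> (+) (-x) ` U" using \<open>x \<in> U\<close> by (simp add: translation_image_iff)
  ultimately obtain W where W: "openin \<sigma> W" "0 \<in> W" "absolutely_convex W" "W \<subseteq> (+) (-x) ` U"
    by (rule lcs_absolutely_convex_nhd[OF assms(1)])
  have "W \<in> bornivorous_discs T"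
    using W assms(2) by (intro bornivorous_disc_of_nhd0[of \<sigma>]) (auto intro: nhd0_openI)
  moreover have "(+) x ` W \<subseteq> U"
  proof
    fix z assume "z \<in> (+) x ` W"
    then have "z - x \<in> (+) (-x) ` U" using W(4) by (auto simp: translation_image_iff)
    then show "z \<in> U" by (simp only: translation_image_iff) simp
  qed
  ultimately show "\<exists>S\<in>bornivorous_discs T. (+) x ` S \<subseteq> U" ..
qed

lemma convex_interior_of_bornological_topology:
  assumes "convex S"
  shows "convex (bornological_topology T interior_of S)"
  unfolding convex_def
proof (intro ballI allI impI)
  fix x y and u v :: real
  assume "x \<in> bornological_topology T interior_of S" "y \<in> bornological_topology T interior_of S"
    and uv: "0 \<le> u" "0 \<le> v" "u + v = 1"
  then obtain W W' where W: "W \<in> bornivorous_discs T" "(+) x ` W \<subseteq> S"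
    and W': "W' \<in> bornivorous_discs T" "(+) y ` W' \<subseteq> S"
    unfolding in_interior_of_bornological_topology by blast
  \<comment> \<open>\<open>u x + v y + w = u (x + w) + v (y + w)\<close>\<close>
  have "(+) (u *\<^sub>R x + v *\<^sub>R y) ` (W \<inter> W') \<subseteq> S"
  proof
    fix z assume "z \<in> (+) (u *\<^sub>R x + v *\<^sub>R y) ` (W \<inter> W')"
    then obtain w where w: "w \<in> W" "w \<in> W'" "z = u *\<^sub>R x + v *\<^sub>R y + w" by blast
    have "x + w \<in> S" "y + w \<in> S" using W(2) W'(2) w by auto
    then have "u *\<^sub>R (x + w) + v *\<^sub>R (y + w) \<in> S" using assms uv by (intro convexD) auto
    moreover have "u *\<^sub>R (x + w) + v *\<^sub>R (y + w) = z"
      using w(3) uv(3) by (simp add: algebra_simps flip: scaleR_add_left)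
    ultimately show "z \<in> S" by simp
  qed
  then show "u *\<^sub>R x + v *\<^sub>R y \<in> bornological_topology T interior_of S"
    using bornivorous_discs_Int[OF W(1) W'(1)] by (auto simp: in_interior_of_bornological_topology)
qed

lemma continuous_map_bornological_topology_add:
  "continuous_map (prod_topology (bornological_topology T) (bornological_topology T))
     (bornological_topology T) (\<lambda>(x, y). x + y)"
  unfolding continuous_map
proof (intro conjI allI impI)
  let ?X = "bornological_topology T"
  show "(\<lambda>(x, y). x + y) ` topspace (prod_topology ?X ?X) \<subseteq> topspace ?X"
    by (simp add: topspace_bornological_topology)
  fix U assume U: "openin ?X U"
  show "openin (prod_topology ?X ?X) {p \<in> topspace (prod_topology ?X ?X). (case p of (x, y) \<Rightarrow> x + y) \<in> U}"
    unfolding openin_prod_topology_alt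
  proof (intro allI impI)
    fix x y assume "(x, y) \<in> {p \<in> topspace (prod_topology ?X ?X). (case p of (x, y) \<Rightarrow> x + y) \<in> U}"
    then have "x + y \<in> U" by simp
    then obtain S where S: "S \<in> bornivorous_discs T" "(+) (x + y) ` S \<subseteq> U"
      using bspec[OF U[unfolded openin_bornological_topology]] by blast
    define H where "H = (*\<^sub>R) (1/2) ` S"
    have H: "H \<in> bornivorous_discs T" unfolding H_def using S(1) by (simp add: bornivorous_discs_scaleR)
    define I where "I = ?X interior_of H"
    have "openin ?X ((+) x ` I)" "openin ?X ((+) y ` I)"
      unfolding I_def by (intro openin_bornological_topology_translation openin_interior_of)+
    moreover have "x \<in> (+) x ` I" "y \<in> (+) y ` I"
      using zero_mem_interior_of_bornivorous_disc[OF H] by (auto simp: I_def translation_image_iff)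
    moreover have "(+) x ` I \<times> (+) y ` I \<subseteq>
        {p \<in> topspace (prod_topology ?X ?X). (case p of (x, y) \<Rightarrow> x + y) \<in> U}"
    proof
      fix p assume "p \<in> (+) x ` I \<times> (+) y ` I"
      then obtain a b where p: "p = (a, b)" "a - x \<in> H" "b - y \<in> H"
        using interior_of_subset[of ?X H] by (force simp: I_def translation_image_iff)
      then have "(a - x) + (b - y) \<in> S"
        using bornivorous_disc_convex[OF S(1)] by (intro convex_balanced_half_sum) (auto simp: H_def)
      then have "a + b \<in> U" using S(2) by (force simp: translation_image_iff algebra_simps)
      then show "p \<in> {p \<in> topspace (prod_topology ?X ?X). (case p of (x, y) \<Rightarrow> x + y) \<in> U}"
        using p(1) by (simp add: topspace_bornological_topology)
    qed
    ultimately show "\<exists>V W. openin ?X V \<and> openin ?X W \<and> x \<in> V \<and> y \<in> W \<and>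
        V \<times> W \<subseteq> {p \<in> topspace (prod_topology ?X ?X). (case p of (x, y) \<Rightarrow> x + y) \<in> U}"
      by blast
  qed
qed

lemma continuous_map_bornological_topology_scaleR:
  assumes "tvs_topology T"
  shows "continuous_map (prod_topology euclideanreal (bornological_topology T))
           (bornological_topology T) (\<lambda>(c, x). c *\<^sub>R x)"
  unfolding continuous_map
proof (intro conjI allI impI)
  let ?X = "bornological_topology T"
  show "(\<lambda>(c, x). c *\<^sub>R x) ` topspace (prod_topology euclideanreal ?X) \<subseteq> topspace ?X"
    by (simp add: topspace_bornological_topology)
  fix U assume U: "openin ?X U"
  define P where "P = {p \<in> topspace (prod_topology euclideanreal ?X). (case p of (c, x) \<Rightarrow> c *\<^sub>R x) \<in> U}"
  have "openin (prod_topology euclideanreal ?X) P"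
    unfolding openin_prod_topology_alt
  proof (intro allI impI)
    fix c0 x0 assume "(c0, x0) \<in> P"
    then have "c0 *\<^sub>R x0 \<in> U" by (simp add: P_def)
    then obtain S where S: "S \<in> bornivorous_discs T" "(+) (c0 *\<^sub>R x0) ` S \<subseteq> U"
      using bspec[OF U[unfolded openin_bornological_topology]] by blast
    define H where "H = (*\<^sub>R) (1/2) ` S"
    have H: "H \<in> bornivorous_discs T" unfolding H_def using S(1) by (simp add: bornivorous_discs_scaleR)
    define M where "M = \<bar>c0\<bar> + 1"
    have "M > 0" by (simp add: M_def)
    define W where "W = (*\<^sub>R) (1/M) ` H"
    have W: "W \<in> bornivorous_discs T" unfolding W_def using H \<open>M > 0\<close> by (simp add: bornivorous_discs_scaleR)
    obtain d where d: "d > 0" "\<And>t. \<bar>t\<bar> \<le> d \<Longrightarrow> t *\<^sub>R x0 \<in> H"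
      using bornivorous_disc_radial[OF assms H] by blast
    define I where "I = ?X interior_of W"
    have "openin euclideanreal (ball c0 (min 1 d))" by simp
    moreover have "openin ?X ((+) x0 ` I)"
      unfolding I_def by (intro openin_bornological_topology_translation openin_interior_of)
    moreover have "c0 \<in> ball c0 (min 1 d)" "x0 \<in> (+) x0 ` I"
      using d zero_mem_interior_of_bornivorous_disc[OF W] by (auto simp: I_def translation_image_iff)
    moreover have "ball c0 (min 1 d) \<times> (+) x0 ` I \<subseteq> P"
    proof
      fix p assume "p \<in> ball c0 (min 1 d) \<times> (+) x0 ` I"
      then obtain c x where p: "p = (c, x)" "\<bar>c - c0\<bar> < min 1 d" "x - x0 \<in> W"
        using interior_of_subset[of ?X W]
        by (force simp: I_def translation_image_iff dist_real_def abs_minus_commute)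
      \<comment> \<open>\<open>c x - c0 x0 = c (x - x0) + (c - c0) x0\<close>, both summands lie in \<open>H = S/2\<close>\<close>
      have "M *\<^sub>R (x - x0) \<in> H" using p(3) \<open>M > 0\<close> by (simp add: W_def scaleR_image_iff)
      moreover have "\<bar>c\<bar> \<le> M" using p(2) by (simp add: M_def abs_le_iff abs_less_iff) linarith
      then have "\<bar>c / M\<bar> \<le> 1" using \<open>M > 0\<close> by (simp add: abs_divide)
      ultimately have "(c / M) *\<^sub>R (M *\<^sub>R (x - x0)) \<in> H"
        by (rule balanced_setD[OF bornivorous_disc_balanced[OF H]])
      then have "c *\<^sub>R (x - x0) \<in> H" using \<open>M > 0\<close> by simp
      moreover have "(c - c0) *\<^sub>R x0 \<in> H" using p(2) d(2) by simp
      ultimately have "c *\<^sub>R (x - x0) + (c - c0) *\<^sub>R x0 \<in> S"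
        using bornivorous_disc_convex[OF S(1)] by (intro convex_balanced_half_sum) (auto simp: H_def)
      then have "c *\<^sub>R x \<in> U"
        using S(2) by (force simp: translation_image_iff algebra_simps)
      then show "p \<in> P" using p(1) by (simp add: P_def topspace_bornological_topology)
    qed
    ultimately show "\<exists>V W. openin euclideanreal V \<and> openin ?X W \<and> c0 \<in> V \<and> x0 \<in> W \<and> V \<times> W \<subseteq> P"
      by blast
  qed
  then show "openin (prod_topology euclideanreal ?X)
    {p \<in> topspace (prod_topology euclideanreal ?X). (case p of (c, x) \<Rightarrow> c *\<^sub>R x) \<in> U}"
    by (simp add: P_def)
qed

lemma lcs_bornological_topology:
  assumes "lcs_topology T"
  shows "lcs_topology (bornological_topology T)"
  unfolding lcs_topology_def
proof (intro conjI allI impI)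
  show "tvs_topology (bornological_topology T)"
    unfolding tvs_topology_def
    using continuous_map_bornological_topology_add continuous_map_bornological_topology_scaleR[OF lcs_tvs[OF assms]]
    by (simp add: topspace_bornological_topology)
  show "Hausdorff_space (bornological_topology T)"
    unfolding Hausdorff_space_def
  proof (intro allI impI)
    fix x y assume "x \<in> topspace (bornological_topology T) \<and> y \<in> topspace (bornological_topology T) \<and> x \<noteq> y"
    then have "x \<in> topspace T" "y \<in> topspace T" "x \<noteq> y"
      using tvs_topspace[OF lcs_tvs[OF assms]] by auto
    then obtain U V where "openin T U" "openin T V" "x \<in> U" "y \<in> V" "disjnt U V"
      using assms unfolding lcs_topology_def Hausdorff_space_def by blast
    then show "\<exists>U V. openin (bornological_topology T) U \<and> openin (bornological_topology T) V \<and>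
        x \<in> U \<and> y \<in> V \<and> disjnt U V"
      using openin_bornological_topologyI[OF assms] by blast
  qed
  fix U assume "openin (bornological_topology T) U \<and> 0 \<in> U"
  then obtain S where S: "S \<in> bornivorous_discs T" "(+) 0 ` S \<subseteq> U"
    unfolding openin_bornological_topology by blast
  show "\<exists>V. openin (bornological_topology T) V \<and> 0 \<in> V \<and> convex V \<and> V \<subseteq> U"
  proof (intro exI conjI)
    show "openin (bornological_topology T) (bornological_topology T interior_of S)"
      by (rule openin_interior_of)
    show "0 \<in> bornological_topology T interior_of S"
      using S(1) by (rule zero_mem_interior_of_bornivorous_disc)
    show "convex (bornological_topology T interior_of S)"
      using bornivorous_disc_convex[OF S(1)] by (rule convex_interior_of_bornological_topology)
    show "bornological_topology T interior_of S \<subseteq> U"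
      using interior_of_subset[of "bornological_topology T" S] S(2) by simp
  qed
qed

lemma tvs_bounded_bornological_topology_iff:
  assumes "lcs_topology T"
  shows "tvs_bounded (bornological_topology T) B \<longleftrightarrow> tvs_bounded T B"
proof
  assume "tvs_bounded (bornological_topology T) B"
  moreover have "nhd0 T U \<Longrightarrow> nhd0 (bornological_topology T) U" for U
    using openin_bornological_topologyI[OF assms] unfolding nhd0_def by blast
  ultimately show "tvs_bounded T B" unfolding tvs_bounded_def by blast
next
  assume B: "tvs_bounded T B"
  show "tvs_bounded (bornological_topology T) B"
    unfolding tvs_bounded_def nhd0_bornological_topology_iff
    using bornivorous_disc_absorbs[OF _ B] absorbs_mono by blast
qed

lemma bornological_topology_eq:
  assumes "lcs_topology T" "bornological T"
  shows "bornological_topology T = T"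
proof (rule topology_eq[THEN iffD2, rule_format])
  fix U
  show "openin (bornological_topology T) U \<longleftrightarrow> openin T U"
  proof
    assume U: "openin (bornological_topology T) U"
    show "openin T U"
    proof (subst openin_subopen, intro ballI)
      fix x assume "x \<in> U"
      then obtain S where S: "S \<in> bornivorous_discs T" "(+) x ` S \<subseteq> U"
        using bspec[OF U[unfolded openin_bornological_topology]] by blast
      then obtain V where V: "openin T V" "0 \<in> V" "V \<subseteq> S"
        using assms(2) unfolding bornological_def bornivorous_discs_def nhd0_def by blast
      have "openin T ((+) x ` V)" by (rule openin_tvs_translation[OF lcs_tvs[OF assms(1)] V(1)])
      moreover have "x \<in> (+) x ` V" using V(2) by (simp add: translation_image_iff)
      moreover have "(+) x ` V \<subseteq> U" using V(3) S(2) by (meson image_mono subset_trans)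
      ultimately show "\<exists>W. openin T W \<and> x \<in> W \<and> W \<subseteq> U" by blast
    qed
  qed (rule openin_bornological_topologyI[OF assms(1)])
qed

section \<open>Prefix cores and the strong Pytkeev property\<close>

definition prefix_core :: "((nat \<Rightarrow> nat) \<Rightarrow> 'b set) \<Rightarrow> nat list \<Rightarrow> 'b set" where
  "prefix_core N s = (\<Inter>\<beta>\<in>{\<beta>. \<forall>i<length s. \<beta> i = s ! i}. N \<beta>)"

lemma prefix_core_subset: "\<forall>i<length s. \<beta> i = s ! i \<Longrightarrow> prefix_core N s \<subseteq> N \<beta>"
  unfolding prefix_core_def by blast

lemma prefix_coreI: "(\<And>\<beta>. \<forall>i<length s. \<beta> i = s ! i \<Longrightarrow> z \<in> N \<beta>) \<Longrightarrow> z \<in> prefix_core N s"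
  unfolding prefix_core_def by blast

lemma prefix_core_Nil: "prefix_core N [] = (\<Inter>\<alpha>. N \<alpha>)"
  by (simp add: prefix_core_def)

lemma prefix_core_subset_dominated:
  assumes "antimono N" "\<forall>i<length s. u i \<le> s ! i"
  shows "prefix_core N s \<subseteq> N u"
proof -
  define \<beta> where "\<beta> i = (if i < length s then s ! i else u i)" for i
  have "prefix_core N s \<subseteq> N \<beta>" by (rule prefix_core_subset) (simp add: \<beta>_def)
  also have "N \<beta> \<subseteq> N u"
    using assms by (intro antimonoD[OF assms(1)]) (simp add: le_fun_def \<beta>_def)
  finally show ?thesis .
qed

lemma prefix_core_append_antimono:
  assumes "antimono N" "j \<le> j'"
  shows "prefix_core N (s @ [j']) \<subseteq> prefix_core N (s @ [j])"
proof
  fix z assume z: "z \<in> prefix_core N (s @ [j'])"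
  show "z \<in> prefix_core N (s @ [j])"
  proof (rule prefix_coreI)
    fix \<beta> assume \<beta>: "\<forall>i<length (s @ [j]). \<beta> i = (s @ [j]) ! i"
    have "prefix_core N (s @ [j']) \<subseteq> N (\<beta>(length s := j'))"
      using \<beta> by (intro prefix_core_subset) (auto simp: nth_append less_Suc_eq)
    with z have "z \<in> N (\<beta>(length s := j'))" by blast
    moreover have "\<beta> \<le> \<beta>(length s := j')"
      using \<beta> assms(2) by (auto simp: le_fun_def nth_append)
    then have "N (\<beta>(length s := j')) \<subseteq> N \<beta>" by (rule antimonoD[OF assms(1)])
    ultimately show "z \<in> N \<beta>" by blast
  qed
qed

lemma INT_prefix_core_append_subset:
  assumes "antimono N"
  shows "(\<Inter>j\<in>{m..}. prefix_core N (s @ [j])) \<subseteq> prefix_core N s"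
proof
  fix z assume z: "z \<in> (\<Inter>j\<in>{m..}. prefix_core N (s @ [j]))"
  show "z \<in> prefix_core N s"
  proof (rule prefix_coreI)
    fix \<beta> assume \<beta>: "\<forall>i<length s. \<beta> i = s ! i"
    define j where "j = max (\<beta> (length s)) m"
    have "prefix_core N (s @ [j]) \<subseteq> N (\<beta>(length s := j))"
      using \<beta> by (intro prefix_core_subset) (auto simp: nth_append less_Suc_eq)
    moreover have "z \<in> prefix_core N (s @ [j])" using z by (simp add: j_def)
    ultimately have "z \<in> N (\<beta>(length s := j))" by blast
    moreover have "\<beta> \<le> \<beta>(length s := j)" by (simp add: le_fun_def j_def)
    then have "N (\<beta>(length s := j)) \<subseteq> N \<beta>" by (rule antimonoD[OF assms])
    ultimately show "z \<in> N \<beta>" by blast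
  qed
qed

lemma decreasing_finite_sets_eventually_empty:
  fixes F :: "nat \<Rightarrow> 'a set"
  assumes "finite (F m)" "\<And>j j'. m \<le> j \<Longrightarrow> j \<le> j' \<Longrightarrow> F j' \<subseteq> F j" "(\<Inter>j\<in>{m..}. F j) = {}"
  obtains j where "m \<le> j" "F j = {}"
proof -
  have "\<forall>a\<in>F m. \<exists>j\<ge>m. a \<notin> F j" using assms(3) by blast
  then obtain g where g: "\<And>a. a \<in> F m \<Longrightarrow> m \<le> g a \<and> a \<notin> F (g a)" by metis
  define J where "J = Max (insert m (g ` F m))"
  have J: "m \<le> J" "\<And>a. a \<in> F m \<Longrightarrow> g a \<le> J" using assms(1) by (auto simp: J_def)
  have "F J = {}"
  proof (rule equals0I)
    fix a assume "a \<in> F J"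
    then have "a \<in> F m" using assms(2)[OF order_refl J(1)] by blast
    then have "m \<le> g a" "a \<notin> F (g a)" "g a \<le> J" using g J(2) by auto
    then show False using assms(2) \<open>a \<in> F J\<close> by blast
  qed
  then show ?thesis using that J(1) by blast
qed

lemma nat_list_infinite_branch:
  assumes "P []" "\<And>s. P s \<Longrightarrow> \<exists>j. P (s @ [j])"
  shows "\<exists>\<alpha> :: nat \<Rightarrow> nat. \<forall>n. P (map \<alpha> [0..<n])"
proof -
  have "\<exists>f. \<forall>n. (P (f n) \<and> length (f n) = n) \<and> (\<exists>j. f (Suc n) = f n @ [j])"
  proof (rule dependent_nat_choice)
    show "\<exists>s. P s \<and> length s = 0" using assms(1) by blast
    fix s n assume s: "P s \<and> length s = n"
    then obtain j where "P (s @ [j])" using assms(2) by blast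
    then show "\<exists>s'. (P s' \<and> length s' = Suc n) \<and> (\<exists>j. s' = s @ [j])" using s by auto
  qed
  then obtain f where f: "\<And>n. P (f n) \<and> length (f n) = n" "\<And>n. \<exists>j. f (Suc n) = f n @ [j]"
    by blast
  have eq: "f n = map (\<lambda>i. f (Suc i) ! i) [0..<n]" for n
  proof (induction n)
    case 0 then show ?case using f(1)[of 0] by simp
  next
    case (Suc n)
    obtain j where "f (Suc n) = f n @ [j]" using f(2) by blast
    then show ?case using Suc f(1)[of n] by (simp add: nth_append)
  qed
  then show ?thesis using f(1) by metis
qed

lemma strong_Pytkeev_witness:
  fixes N :: "(nat \<Rightarrow> nat) \<Rightarrow> 'b set"
  assumes anti: "antimono N"
    and nhd: "\<And>\<alpha>. \<exists>V. openin X V \<and> x \<in> V \<and> V \<subseteq> N \<alpha>"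
    and base: "\<And>U. openin X U \<Longrightarrow> x \<in> U \<Longrightarrow> \<exists>\<alpha>. N \<alpha> \<subseteq> U"
    and Inter: "(\<Inter>\<alpha>. N \<alpha>) \<subseteq> {x}"
    and finitary: "\<And>\<alpha>. N \<alpha> \<subseteq> (\<Union>n. prefix_core N (map \<alpha> [0..<n]))"
    and U: "openin X U" "x \<in> U" and A: "x \<in> X closure_of A" "x \<notin> A"
  shows "\<exists>s. prefix_core N s \<subseteq> U \<and> infinite (prefix_core N s \<inter> A)"
proof (rule ccontr)
  assume "\<nexists>s. prefix_core N s \<subseteq> U \<and> infinite (prefix_core N s \<inter> A)"
  then have fin: "finite (prefix_core N s \<inter> A)" if "prefix_core N s \<subseteq> U" for s
    using that by blast
  obtain u where u: "N u \<subseteq> U" using base[OF U] by blast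
  \<comment> \<open>a branch dominating \<open>u\<close> all of whose prefix cores miss \<open>A\<close> contradicts \<open>x \<in> closure A\<close>\<close>
  define good where "good s \<longleftrightarrow> (\<forall>i<length s. u i \<le> s ! i) \<and> prefix_core N s \<inter> A = {}" for s
  have "good []" using Inter A(2) by (auto simp: good_def prefix_core_Nil)
  moreover have "\<exists>j. good (s @ [j])" if "good s" for s
  proof -
    define F where "F j = prefix_core N (s @ [j]) \<inter> A" for j
    define m where "m = u (length s)"
    have dom: "\<forall>i<length (s @ [j]). u i \<le> (s @ [j]) ! i" if "m \<le> j" for j
      using \<open>good s\<close> that by (auto simp: good_def m_def nth_append less_Suc_eq)
    have "finite (F m)"
      unfolding F_def using prefix_core_subset_dominated[OF anti dom] u by (intro fin) auto
    moreover have "F j' \<subseteq> F j" if "j \<le> j'" for j j'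
      using prefix_core_append_antimono[OF anti that] by (auto simp: F_def)
    moreover have "(\<Inter>j\<in>{m..}. F j) = {}"
      using INT_prefix_core_append_subset[OF anti, where m=m and s=s] \<open>good s\<close> by (auto simp: F_def good_def)
    ultimately obtain j where "m \<le> j" "F j = {}" by (rule decreasing_finite_sets_eventually_empty)
    then show ?thesis using dom by (auto simp: good_def F_def)
  qed
  ultimately obtain \<alpha> where \<alpha>: "\<And>n. good (map \<alpha> [0..<n])"
    using nat_list_infinite_branch[of good] by blast
  obtain V where "openin X V" "x \<in> V" "V \<subseteq> N \<alpha>" using nhd by blast
  then obtain a where "a \<in> A" "a \<in> N \<alpha>" using A(1) unfolding in_closure_of by blast
  then obtain n where "a \<in> prefix_core N (map \<alpha> [0..<n]) \<inter> A" using finitary by blast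
  then show False using \<alpha>[of n] unfolding good_def by blast
qed

section \<open>A \<open>\<GG>\<close>-base of the bornological topology\<close>

definition balanced_hull :: "'a::real_vector set \<Rightarrow> 'a set" where
  "balanced_hull B = {c *\<^sub>R x |c x. \<bar>c\<bar> \<le> 1 \<and> x \<in> B}"

lemma balanced_set_balanced_hull: "balanced_set (balanced_hull B)"
  unfolding balanced_set_def balanced_hull_def
proof (intro ballI allI impI)
  fix y and t :: real
  assume "y \<in> {c *\<^sub>R x |c x. \<bar>c\<bar> \<le> 1 \<and> x \<in> B}" "\<bar>t\<bar> \<le> 1"
  then obtain c x where "y = c *\<^sub>R x" "\<bar>c\<bar> \<le> 1" "x \<in> B" "\<bar>t\<bar> \<le> 1" by blast
  moreover have "\<bar>t * c\<bar> \<le> 1" using calculation by (simp add: abs_mult mult_le_one)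
  ultimately show "t *\<^sub>R y \<in> {c *\<^sub>R x |c x. \<bar>c\<bar> \<le> 1 \<and> x \<in> B}" by force
qed

lemma subset_balanced_hull: "B \<subseteq> balanced_hull B"
  unfolding balanced_hull_def by (force intro: exI[of _ 1])

definition G_base_set :: "(nat \<Rightarrow> 'a::real_vector set) \<Rightarrow> (nat \<Rightarrow> nat) \<Rightarrow> 'a set" where
  "G_base_set Bs \<alpha> = convex hull (\<Union>n. (*\<^sub>R) (1 / (real (\<alpha> n) + 1)) ` balanced_hull (Bs n))"

lemma G_base_set_bornivorous_disc:
  assumes "fundamental_sequence_bounded T Bs"
  shows "G_base_set Bs \<alpha> \<in> bornivorous_discs T"
proof (rule bornivorous_discsI)
  show "convex (G_base_set Bs \<alpha>)" by (simp add: G_base_set_def)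
  show "balanced_set (G_base_set Bs \<alpha>)"
    unfolding G_base_set_def
    by (intro balanced_set_convex_hull balanced_set_UN balanced_set_scaleR_image
        balanced_set_balanced_hull)
  fix B assume "tvs_bounded T B"
  then obtain n where "B \<subseteq> Bs n" using assms unfolding fundamental_sequence_bounded_def by blast
  have "B \<subseteq> (*\<^sub>R) (real (\<alpha> n) + 1) ` G_base_set Bs \<alpha>"
  proof
    fix x assume "x \<in> B"
    then have "x \<in> balanced_hull (Bs n)" using \<open>B \<subseteq> Bs n\<close> subset_balanced_hull by blast
    then have "x /\<^sub>R (real (\<alpha> n) + 1) \<in> (*\<^sub>R) (1 / (real (\<alpha> n) + 1)) ` balanced_hull (Bs n)"
      by (intro image_eqI[where x=x]) (simp_all add: inverse_eq_divide)
    then have "x /\<^sub>R (real (\<alpha> n) + 1) \<in> G_base_set Bs \<alpha>"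
      unfolding G_base_set_def by (intro hull_inc) blast
    then show "x \<in> (*\<^sub>R) (real (\<alpha> n) + 1) ` G_base_set Bs \<alpha>"
      by (simp add: scaleR_image_iff add_nonneg_eq_0_iff)
  qed
  then show "absorbs (G_base_set Bs \<alpha>) B"
    unfolding absorbs_def by (intro exI[of _ "real (\<alpha> n) + 1"]) simp
qed

lemma antimono_G_base_set: "antimono (G_base_set Bs)"
proof (rule antimonoI)
  fix \<alpha> \<beta> :: "nat \<Rightarrow> nat" assume "\<alpha> \<le> \<beta>"
  have "(*\<^sub>R) (1 / (real (\<beta> n) + 1)) ` balanced_hull (Bs n)
      \<subseteq> (*\<^sub>R) (1 / (real (\<alpha> n) + 1)) ` balanced_hull (Bs n)" for n
    using \<open>\<alpha> \<le> \<beta>\<close> by (intro balanced_set_scaleR_image_mono balanced_set_balanced_hull)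
      (auto simp: le_fun_def frac_le)
  then show "G_base_set Bs \<beta> \<le> G_base_set Bs \<alpha>"
    unfolding G_base_set_def by (intro hull_mono UN_mono) auto
qed

lemma G_base_set_subset:
  assumes "fundamental_sequence_bounded T Bs" "S \<in> bornivorous_discs T"
  obtains \<alpha> where "G_base_set Bs \<alpha> \<subseteq> S"
proof -
  have "\<forall>n. \<exists>c>0. Bs n \<subseteq> (*\<^sub>R) c ` S"
    using assms bornivorous_disc_absorbs unfolding fundamental_sequence_bounded_def absorbs_def
    by blast
  then obtain c where c: "\<And>n. c n > 0" "\<And>n. Bs n \<subseteq> (*\<^sub>R) (c n) ` S" by metis
  define \<alpha> where "\<alpha> n = nat \<lceil>c n\<rceil>" for n
  have "(*\<^sub>R) (1 / (real (\<alpha> n) + 1)) ` balanced_hull (Bs n) \<subseteq> S" for n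
  proof
    fix y assume "y \<in> (*\<^sub>R) (1 / (real (\<alpha> n) + 1)) ` balanced_hull (Bs n)"
    then obtain t x where y: "y = (1 / (real (\<alpha> n) + 1)) *\<^sub>R (t *\<^sub>R x)" "\<bar>t\<bar> \<le> 1" "x \<in> Bs n"
      unfolding balanced_hull_def by blast
    obtain s where s: "s \<in> S" "x = c n *\<^sub>R s" using c(2)[of n] y(3) by blast
    have "\<bar>t * c n\<bar> \<le> c n"
      using y(2) c(1)[of n] by (simp add: abs_mult mult_left_le_one_le)
    also have "c n \<le> real (\<alpha> n) + 1" using c(1)[of n] by (simp add: \<alpha>_def) linarith
    finally have "\<bar>t * c n\<bar> \<le> real (\<alpha> n) + 1" .
    then have "\<bar>t * c n / (real (\<alpha> n) + 1)\<bar> \<le> 1" by (simp add: abs_divide)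
    moreover have "y = (t * c n / (real (\<alpha> n) + 1)) *\<^sub>R s" using y(1) s(2) by simp
    ultimately show "y \<in> S" using balanced_setD[OF bornivorous_disc_balanced[OF assms(2)] s(1)] by simp
  qed
  then have "G_base_set Bs \<alpha> \<subseteq> S"
    unfolding G_base_set_def using bornivorous_disc_convex[OF assms(2)] by (intro hull_minimal) auto
  then show ?thesis by (rule that)
qed

lemma convex_hull_UN_nat_subset:
  fixes L :: "nat \<Rightarrow> 'a::real_vector set"
  shows "convex hull (\<Union>n. L n) \<subseteq> (\<Union>N. convex hull (\<Union>n<N. L n))"
proof
  fix y assume "y \<in> convex hull (\<Union>n. L n)"
  then obtain S u where S: "finite S" "S \<subseteq> (\<Union>n. L n)" "\<forall>x\<in>S. 0 \<le> u x" "sum u S = 1"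
    "(\<Sum>v\<in>S. u v *\<^sub>R v) = y"
    unfolding convex_hull_explicit by blast
  have "\<forall>x\<in>S. \<exists>n. x \<in> L n" using S(2) by blast
  then obtain k where k: "\<And>x. x \<in> S \<Longrightarrow> x \<in> L (k x)" by metis
  define N where "N = Suc (Max (k ` S))"
  have "S \<subseteq> (\<Union>n<N. L n)"
  proof
    fix x assume "x \<in> S"
    then have "k x < N" using S(1) by (simp add: N_def le_imp_less_Suc)
    then show "x \<in> (\<Union>n<N. L n)" using k[OF \<open>x \<in> S\<close>] by blast
  qed
  then have "y \<in> convex hull (\<Union>n<N. L n)"
    unfolding convex_hull_explicit mem_Collect_eq using S(1,3-5) by (intro exI[of _ S] exI[of _ u]) simp
  then show "y \<in> (\<Union>N. convex hull (\<Union>n<N. L n))" by blast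
qed

lemma G_base_set_finitary:
  "G_base_set Bs \<alpha> \<subseteq> (\<Union>N. prefix_core (G_base_set Bs) (map \<alpha> [0..<N]))"
proof -
  let ?L = "\<lambda>\<alpha> n. (*\<^sub>R) (1 / (real (\<alpha> n) + 1)) ` balanced_hull (Bs n)"
  have core: "convex hull (\<Union>n<N. ?L \<alpha> n) \<subseteq> prefix_core (G_base_set Bs) (map \<alpha> [0..<N])" for N
  proof
    fix z assume z: "z \<in> convex hull (\<Union>n<N. ?L \<alpha> n)"
    show "z \<in> prefix_core (G_base_set Bs) (map \<alpha> [0..<N])"
    proof (rule prefix_coreI)
      fix \<beta> assume "\<forall>i<length (map \<alpha> [0..<N]). \<beta> i = map \<alpha> [0..<N] ! i"
      then have "(\<Union>n<N. ?L \<alpha> n) = (\<Union>n<N. ?L \<beta> n)" by (intro SUP_cong) auto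
      also have "\<dots> \<subseteq> (\<Union>n. ?L \<beta> n)" by (rule UN_mono) auto
      finally have "(\<Union>n<N. ?L \<alpha> n) \<subseteq> (\<Union>n. ?L \<beta> n)" .
      then have "convex hull (\<Union>n<N. ?L \<alpha> n) \<subseteq> G_base_set Bs \<beta>"
        unfolding G_base_set_def by (rule hull_mono)
      then show "z \<in> G_base_set Bs \<beta>" using z by blast
    qed
  qed
  have "G_base_set Bs \<alpha> \<subseteq> (\<Union>N. convex hull (\<Union>n<N. ?L \<alpha> n))"
    unfolding G_base_set_def by (rule convex_hull_UN_nat_subset)
  also have "\<dots> \<subseteq> (\<Union>N. prefix_core (G_base_set Bs) (map \<alpha> [0..<N]))"
    using core by (rule UN_mono[OF order_refl])
  finally show ?thesis .
qed

lemma has_G_base_bornological_topology: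
  assumes "fundamental_sequence_bounded T Bs"
  shows "has_G_base (bornological_topology T)"
  unfolding has_G_base_def
proof (intro exI[of _ "G_base_set Bs"] conjI allI impI)
  show "nhd0 (bornological_topology T) (G_base_set Bs \<alpha>)" for \<alpha>
    using G_base_set_bornivorous_disc[OF assms] by (auto simp: nhd0_bornological_topology_iff)
  show "\<exists>\<alpha>. G_base_set Bs \<alpha> \<subseteq> W" if W: "nhd0 (bornological_topology T) W" for W
  proof -
    obtain S where S: "S \<in> bornivorous_discs T" "S \<subseteq> W"
      using W by (auto simp: nhd0_bornological_topology_iff)
    obtain \<alpha> where "G_base_set Bs \<alpha> \<subseteq> S" using G_base_set_subset[OF assms S(1)] .
    then show ?thesis using S(2) by blast
  qed
  show "G_base_set Bs \<beta> \<subseteq> G_base_set Bs \<alpha>" if "\<forall>i. \<alpha> i \<le> \<beta> i" for \<alpha> \<beta>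
    using antimonoD[OF antimono_G_base_set, of \<alpha> \<beta>] that by (simp add: le_fun_def)
qed

section \<open>The strong Pytkeev property of the bornological topology\<close>

lemma image_prefix_core_subset: "f ` prefix_core N s \<subseteq> prefix_core (\<lambda>\<beta>. f ` N \<beta>) s"
proof
  fix z assume "z \<in> f ` prefix_core N s"
  then obtain y where y: "z = f y" "y \<in> prefix_core N s" by (rule imageE)
  show "z \<in> prefix_core (\<lambda>\<beta>. f ` N \<beta>) s"
  proof (rule prefix_coreI)
    fix \<beta> assume "\<forall>i<length s. \<beta> i = s ! i"
    then have "y \<in> N \<beta>" using subsetD[OF prefix_core_subset y(2)] by blast
    then show "z \<in> f ` N \<beta>" using y(1) by (rule rev_image_eqI)
  qed
qed

lemma strong_Pytkeev_bornological_topology: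
  assumes lcs: "lcs_topology T" and Bs: "fundamental_sequence_bounded T Bs"
  shows "strong_Pytkeev (bornological_topology T)"
  unfolding strong_Pytkeev_def
proof
  let ?X = "bornological_topology T"
  fix x
  define N where "N \<alpha> = (+) x ` G_base_set Bs \<alpha>" for \<alpha>
  have anti: "antimono N"
    unfolding N_def by (intro antimonoI image_mono antimonoD[OF antimono_G_base_set])
  have nhd: "\<exists>V. openin ?X V \<and> x \<in> V \<and> V \<subseteq> N \<alpha>" for \<alpha>
  proof (intro exI conjI)
    show "openin ?X ((+) x ` (?X interior_of G_base_set Bs \<alpha>))"
      by (intro openin_bornological_topology_translation openin_interior_of)
    show "x \<in> (+) x ` (?X interior_of G_base_set Bs \<alpha>)"
      using zero_mem_interior_of_bornivorous_disc[OF G_base_set_bornivorous_disc[OF Bs]]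
      by (simp add: translation_image_iff)
    show "(+) x ` (?X interior_of G_base_set Bs \<alpha>) \<subseteq> N \<alpha>"
      unfolding N_def by (intro image_mono interior_of_subset)
  qed
  have base: "\<exists>\<alpha>. N \<alpha> \<subseteq> U" if U: "openin ?X U" "x \<in> U" for U
  proof -
    obtain S where S: "S \<in> bornivorous_discs T" "(+) x ` S \<subseteq> U"
      using U unfolding openin_bornological_topology by blast
    obtain \<alpha> where "G_base_set Bs \<alpha> \<subseteq> S" using G_base_set_subset[OF Bs S(1)] .
    then have "N \<alpha> \<subseteq> U" unfolding N_def using S(2) image_mono subset_trans by metis
    then show ?thesis by (intro exI[of _ \<alpha>])
  qed
  have Inter: "(\<Inter>\<alpha>. N \<alpha>) \<subseteq> {x}"
  proof
    fix y assume y: "y \<in> (\<Inter>\<alpha>. N \<alpha>)"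
    show "y \<in> {x}"
    proof (rule ccontr)
      assume "y \<notin> {x}"
      have "Hausdorff_space ?X" using lcs_bornological_topology[OF lcs] by (simp add: lcs_topology_def)
      then have "\<exists>U V. openin ?X U \<and> openin ?X V \<and> x \<in> U \<and> y \<in> V \<and> disjnt U V"
        using \<open>y \<notin> {x}\<close> unfolding Hausdorff_space_def topspace_bornological_topology by auto
      then obtain U V where U: "openin ?X U" "x \<in> U" and "y \<in> V" "disjnt U V" by blast
      obtain \<alpha> where "N \<alpha> \<subseteq> U" using base[OF U] by blast
      moreover have "y \<in> N \<alpha>" using y by blast
      ultimately show False using \<open>y \<in> V\<close> \<open>disjnt U V\<close> by (auto simp: disjnt_def)
    qed
  qed
  have finitary: "N \<alpha> \<subseteq> (\<Union>n. prefix_core N (map \<alpha> [0..<n]))" for \<alpha>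
  proof -
    have "N \<alpha> \<subseteq> (+) x ` (\<Union>n. prefix_core (G_base_set Bs) (map \<alpha> [0..<n]))"
      unfolding N_def by (intro image_mono G_base_set_finitary)
    also have "\<dots> \<subseteq> (\<Union>n. prefix_core N (map \<alpha> [0..<n]))"
      unfolding image_UN N_def by (intro UN_mono order_refl image_prefix_core_subset)
    finally show ?thesis .
  qed
  have witness: "\<exists>s. prefix_core N s \<subseteq> U \<and> infinite (prefix_core N s \<inter> A)"
    if "openin ?X U" "x \<in> U" "x \<in> ?X closure_of A" "x \<notin> A" for U A
    using strong_Pytkeev_witness[OF anti nhd base Inter finitary that] .
  show "\<exists>\<D>. countable \<D> \<and> (\<forall>D\<in>\<D>. D \<subseteq> topspace ?X) \<and>
     (\<forall>U A. openin ?X U \<and> x \<in> U \<and> A \<subseteq> topspace ?X \<and> x \<in> ?X closure_of A - A \<longrightarrow>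
        (\<exists>D\<in>\<D>. D \<subseteq> U \<and> infinite (D \<inter> A)))"
  proof (intro exI[of _ "range (prefix_core N)"] conjI allI impI)
    show "countable (range (prefix_core N))" by simp
    show "\<forall>D\<in>range (prefix_core N). D \<subseteq> topspace ?X" by (simp add: topspace_bornological_topology)
    fix U A assume "openin ?X U \<and> x \<in> U \<and> A \<subseteq> topspace ?X \<and> x \<in> ?X closure_of A - A"
    then obtain s where "prefix_core N s \<subseteq> U" "infinite (prefix_core N s \<inter> A)"
      using witness[of U A] by auto
    then show "\<exists>D\<in>range (prefix_core N). D \<subseteq> U \<and> infinite (D \<inter> A)" by (intro bexI[OF _ rangeI[of _ s]]) simp
  qed
qed

theorem mainTheorem16:
  fixes \<tau> :: "'a::real_vector topology" and Bs :: "nat \<Rightarrow> 'a set"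
  assumes "lcs_topology \<tau>"
    and "fundamental_sequence_bounded \<tau> Bs"
  shows "\<exists>\<xi>. lcs_topology \<xi> \<and>
           (\<forall>B. tvs_bounded \<xi> B \<longleftrightarrow> tvs_bounded \<tau> B) \<and>
           (\<forall>\<sigma>. lcs_topology \<sigma> \<and> (\<forall>B. tvs_bounded \<sigma> B \<longleftrightarrow> tvs_bounded \<tau> B)
                 \<longrightarrow> (\<forall>U. openin \<sigma> U \<longrightarrow> openin \<xi> U)) \<and>
           has_G_base \<xi> \<and> strong_Pytkeev \<xi> \<and>
           (bornological \<tau> \<longrightarrow> \<tau> = \<xi>)"
proof (intro exI[of _ "bornological_topology \<tau>"] conjI allI impI)
  show "lcs_topology (bornological_topology \<tau>)" by (rule lcs_bornological_topology[OF assms(1)])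
  show "tvs_bounded (bornological_topology \<tau>) B \<longleftrightarrow> tvs_bounded \<tau> B" for B
    by (rule tvs_bounded_bornological_topology_iff[OF assms(1)])
  show "openin (bornological_topology \<tau>) U"
    if "lcs_topology \<sigma> \<and> (\<forall>B. tvs_bounded \<sigma> B \<longleftrightarrow> tvs_bounded \<tau> B)" "openin \<sigma> U" for \<sigma> U
    using that by (intro openin_bornological_topologyI[of \<sigma>]) auto
  show "has_G_base (bornological_topology \<tau>)" by (rule has_G_base_bornological_topology[OF assms(2)])
  show "strong_Pytkeev (bornological_topology \<tau>)"
    by (rule strong_Pytkeev_bornological_topology[OF assms])
  show "\<tau> = bornological_topology \<tau>" if "bornological \<tau>"
    using bornological_topology_eq[OF assms(1) that] by simp
qed

end
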